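(* Let $K$ be a field of characteristic zero and let $A=(A,\Delta,\varepsilon,\xi,\vdash,\dashv,S)$ be a cocommutative Hopf dialgebra over $K$. Then $\mathrm{Glike}(A)$ is a digroup with distinguished bar-unit $\xi$. More precisely: (1) $\mathrm{Glike}(A)$ is closed under $\vdash$ and $\dashv$; (2) $\xi$ is a bar-unit for the restricted products; (3) for every $g\in\mathrm{Glike}(A)$, the element $S(g)$ belongs to $\mathrm{Glike}(A)$ and satisfies $g\vdash S(g)=\xi=S(g)\dashv g$. In particular, the inverse map of the digroup $\mathrm{Glike}(A)$ is the restriction of the antipode $S$.
   Context: A cocommutative Hopf dialgebra $(A,\Delta,\varepsilon,\xi,\vdash,\dashv,S)$ over $K$ consists of a cocommutative $K$-coalgebra $(A,\Delta,\varepsilon)$, two associative bilinear products $\vdash,\dashv:A\otimes A\to A$, an element $\xi\in A$ and a coalgebra morphism $S:A\to A$ such that for all $a,b,c\in A$ (Sweedler notation): (1) $(a\vdash b)\vdash c=(a\dashv b)\vdash c$, $a\dashv(b\dashv c)=a\dashv(b\vdash c)$, $(a\vdash b)\dashv c=a\vdash(b\dashv c)$; (2) $\xi\vdash a=a=a\dashv\xi$ and $a\vdash\xi=\xi\dashv a$; (3) $\Delta(\xi)=\xi\otimes\xi$, $\varepsilon(\xi)=1$; (4) each $\star\in\{\vdash,\dashv\}$ is a coalgebra morphism: $\Delta(a\star b)=\sum(a_{(1)}\star b_{(1)})\otimes(a_{(2)}\star b_{(2)})$ and $\varepsilon(a\star b)=\varepsilon(a)\varepsilon(b)$; (5) $\sum_{(a)}a_{(1)}\vdash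 S(a_{(2)})=\varepsilon(a)\xi=\sum_{(a)}S(a_{(1)})\dashv a_{(2)}$. $\mathrm{Glike}(A)=\{g\in A\mid\Delta(g)=g\otimes g,\ \varepsilon(g)=1\}$. A generalized digroup is a nonempty set $D$ with two associative binary operations $\vdash,\dashv$ satisfying $x\vdash(y\dashv z)=(x\vdash y)\dashv z$, $x\dashv(y\dashv z)=x\dashv(y\vdash z)$, $(x\vdash y)\vdash z=(x\dashv y)\vdash z$, such that there is at least one bar-unit (an element $\xi$ with $x\dashv\xi=x=\xi\vdash x$ for all $x$), and for every bar-unit $\xi$ and every $x\in D$ there are $x^{-1}_{r,\xi},x^{-1}_{l,\xi}\in D$ with $x\vdash x^{-1}_{r,\xi}=\xi$ and $x^{-1}_{l,\xi}\dashv x=\xi$. A digroup is a generalized digroup with a distinguished bar-unit $\xi$ such that every $x\in D$ admits a single inverse $x^{-1}$ satisfying $x\vdash x^{-1}=\xi=x^{-1}\dashv x$. *)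

theory Defs
  imports Complex_Main "HOL-Algebra.Module" "HOL-Algebra.AbelCoset"
begin

section \<open>Tensor products of modules\<close>

definition linear_map ::
  "('k, 'r) ring_scheme \<Rightarrow> ('k, 'm, 'c) module_scheme \<Rightarrow> ('k, 'n, 'd) module_scheme \<Rightarrow> ('m \<Rightarrow> 'n) \<Rightarrow> bool"
  where "linear_map K M N f \<longleftrightarrow>
    f \<in> carrier M \<rightarrow> carrier N \<and>
    (\<forall>x\<in>carrier M. \<forall>y\<in>carrier M. f (x \<oplus>\<^bsub>M\<^esub> y) = f x \<oplus>\<^bsub>N\<^esub> f y) \<and>
    (\<forall>c\<in>carrier K. \<forall>x\<in>carrier M. f (c \<odot>\<^bsub>M\<^esub> x) = c \<odot>\<^bsub>N\<^esub> f x)"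

definition bilinear_map ::
  "('k, 'r) ring_scheme \<Rightarrow> ('k, 'm, 'c) module_scheme \<Rightarrow> ('k, 'n, 'd) module_scheme
    \<Rightarrow> ('k, 'p, 'e) module_scheme \<Rightarrow> ('m \<Rightarrow> 'n \<Rightarrow> 'p) \<Rightarrow> bool"
  where "bilinear_map K M N P b \<longleftrightarrow>
    (\<forall>x\<in>carrier M. linear_map K N P (b x)) \<and>
    (\<forall>y\<in>carrier N. linear_map K M P (\<lambda>x. b x y))"

text \<open>The type \<^typ>\<open>('k, 'm) module\<close> extends rings, so a module record also carries the fields
  \<^const>\<open>mult\<close> and \<^const>\<open>one\<close>. The locale \<^locale>\<open>module\<close> does not use them, and below they are left
  unspecified for modules without a multiplication.\<close>

definition regular_module :: "('k, 'r) ring_scheme \<Rightarrow> ('k, 'k) module"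
  where "regular_module K =
    \<lparr>carrier = carrier K, mult = mult K, one = one K, zero = zero K, add = add K, smult = mult K\<rparr>"

definition free_module :: "('k, 'r) ring_scheme \<Rightarrow> 'x set \<Rightarrow> ('k, 'x \<Rightarrow> 'k) module"
  where "free_module K X =
    \<lparr>carrier = {f. (\<forall>x. f x \<in> carrier K) \<and> {x. f x \<noteq> \<zero>\<^bsub>K\<^esub>} \<subseteq> X \<and> finite {x. f x \<noteq> \<zero>\<^bsub>K\<^esub>}},
     mult = undefined, one = undefined,
     zero = (\<lambda>x. \<zero>\<^bsub>K\<^esub>),
     add = (\<lambda>f g x. f x \<oplus>\<^bsub>K\<^esub> g x),
     smult = (\<lambda>c f x. c \<otimes>\<^bsub>K\<^esub> f x)\<rparr>"

definition free_gen :: "('k, 'r) ring_scheme \<Rightarrow> 'x \<Rightarrow> ('x \<Rightarrow> 'k)"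
  where "free_gen K x = (\<lambda>y. if y = x then \<one>\<^bsub>K\<^esub> else \<zero>\<^bsub>K\<^esub>)"

text \<open>The linear extension of a map \<open>g\<close>, defined on generators, to the free module.\<close>

definition free_lift ::
  "('k, 'r) ring_scheme \<Rightarrow> ('k, 'p, 'c) module_scheme \<Rightarrow> ('x \<Rightarrow> 'p) \<Rightarrow> ('x \<Rightarrow> 'k) \<Rightarrow> 'p"
  where "free_lift K P g f = (\<Oplus>\<^bsub>P\<^esub>x\<in>{x. f x \<noteq> \<zero>\<^bsub>K\<^esub>}. f x \<odot>\<^bsub>P\<^esub> g x)"

text \<open>Elements of the quotient by a submodule \<open>N\<close> are the cosets \<open>N +> x\<close>. In the scalar
  multiplication the pointwise image of a coset under \<open>c\<close> need not be a whole coset (for \<open>c = \<zero>\<close> it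
  is a singleton), so \<open>N\<close> is added to it.\<close>

definition quotient_module :: "('k, 'm, 'c) module_scheme \<Rightarrow> 'm set \<Rightarrow> ('k, 'm set) module"
  where "quotient_module M N =
    \<lparr>carrier = a_rcosets\<^bsub>M\<^esub> N,
     mult = undefined, one = undefined,
     zero = N,
     add = (\<lambda>X Y. X <+>\<^bsub>M\<^esub> Y),
     smult = (\<lambda>c X. \<Union>x\<in>X. N +>\<^bsub>M\<^esub> (c \<odot>\<^bsub>M\<^esub> x))\<rparr>"

definition tensor_relations ::
  "('k, 'r) ring_scheme \<Rightarrow> ('k, 'm, 'c) module_scheme \<Rightarrow> ('k, 'n, 'd) module_scheme \<Rightarrow> ('m \<times> 'n \<Rightarrow> 'k) set"
  where "tensor_relations K M N =
    (let F = free_module K (carrier M \<times> carrier N); e = free_gen K in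
      {e (x \<oplus>\<^bsub>M\<^esub> x', y) \<ominus>\<^bsub>F\<^esub> (e (x, y) \<oplus>\<^bsub>F\<^esub> e (x', y)) | x x' y.
          x \<in> carrier M \<and> x' \<in> carrier M \<and> y \<in> carrier N} \<union>
      {e (x, y \<oplus>\<^bsub>N\<^esub> y') \<ominus>\<^bsub>F\<^esub> (e (x, y) \<oplus>\<^bsub>F\<^esub> e (x, y')) | x y y'.
          x \<in> carrier M \<and> y \<in> carrier N \<and> y' \<in> carrier N} \<union>
      {e (c \<odot>\<^bsub>M\<^esub> x, y) \<ominus>\<^bsub>F\<^esub> c \<odot>\<^bsub>F\<^esub> e (x, y) | c x y.
          c \<in> carrier K \<and> x \<in> carrier M \<and> y \<in> carrier N} \<union>
      {e (x, c \<odot>\<^bsub>N\<^esub> y) \<ominus>\<^bsub>F\<^esub> c \<odot>\<^bsub>F\<^esub> e (x, y) | c x y.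
          c \<in> carrier K \<and> x \<in> carrier M \<and> y \<in> carrier N})"

definition tensor_null ::
  "('k, 'r) ring_scheme \<Rightarrow> ('k, 'm, 'c) module_scheme \<Rightarrow> ('k, 'n, 'd) module_scheme \<Rightarrow> ('m \<times> 'n \<Rightarrow> 'k) set"
  where "tensor_null K M N =
    (\<lambda>H. submodule H K (free_module K (carrier M \<times> carrier N))) hull tensor_relations K M N"

definition tensor_product ::
  "('k, 'r) ring_scheme \<Rightarrow> ('k, 'm, 'c) module_scheme \<Rightarrow> ('k, 'n, 'd) module_scheme
    \<Rightarrow> ('k, ('m \<times> 'n \<Rightarrow> 'k) set) module"
  where "tensor_product K M N =
    quotient_module (free_module K (carrier M \<times> carrier N)) (tensor_null K M N)"

text \<open>The pure tensor \<open>x \<otimes> y\<close>, as a coset.\<close>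

definition tensor ::
  "('k, 'r) ring_scheme \<Rightarrow> ('k, 'm, 'c) module_scheme \<Rightarrow> ('k, 'n, 'd) module_scheme
    \<Rightarrow> 'm \<Rightarrow> 'n \<Rightarrow> ('m \<times> 'n \<Rightarrow> 'k) set"
  where "tensor K M N x y =
    tensor_null K M N +>\<^bsub>free_module K (carrier M \<times> carrier N)\<^esub> free_gen K (x, y)"

text \<open>The linear map \<open>M \<otimes> N \<rightarrow> P\<close> induced by a bilinear map \<open>b\<close>: its linear extension to the free
  module is constant on each coset, and the lift returns that constant value.\<close>

definition tensor_lift ::
  "('k, 'r) ring_scheme \<Rightarrow> ('k, 'm, 'c) module_scheme \<Rightarrow> ('k, 'n, 'd) module_scheme
    \<Rightarrow> ('k, 'p, 'e) module_scheme \<Rightarrow> ('m \<Rightarrow> 'n \<Rightarrow> 'p) \<Rightarrow> ('m \<times> 'n \<Rightarrow> 'k) set \<Rightarrow> 'p"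
  where "tensor_lift K M N P b T = the_elem (free_lift K P (\<lambda>(x, y). b x y) ` T)"

definition tensor_map ::
  "('k, 'r) ring_scheme \<Rightarrow> ('k, 'm, 'c) module_scheme \<Rightarrow> ('k, 'n, 'd) module_scheme
    \<Rightarrow> ('k, 'p, 'e) module_scheme \<Rightarrow> ('k, 'q, 'f) module_scheme
    \<Rightarrow> ('m \<Rightarrow> 'p) \<Rightarrow> ('n \<Rightarrow> 'q) \<Rightarrow> ('m \<times> 'n \<Rightarrow> 'k) set \<Rightarrow> ('p \<times> 'q \<Rightarrow> 'k) set"
  where "tensor_map K M N P Q f g =
    tensor_lift K M N (tensor_product K P Q) (\<lambda>x y. tensor K P Q (f x) (g y))"

definition tensor_swap ::
  "('k, 'r) ring_scheme \<Rightarrow> ('k, 'm, 'c) module_scheme \<Rightarrow> ('k, 'n, 'd) module_scheme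
    \<Rightarrow> ('m \<times> 'n \<Rightarrow> 'k) set \<Rightarrow> ('n \<times> 'm \<Rightarrow> 'k) set"
  where "tensor_swap K M N =
    tensor_lift K M N (tensor_product K N M) (\<lambda>x y. tensor K N M y x)"

text \<open>The associator \<open>(M \<otimes> N) \<otimes> P \<rightarrow> M \<otimes> (N \<otimes> P)\<close>.\<close>

definition tensor_assoc ::
  "('k, 'r) ring_scheme \<Rightarrow> ('k, 'm, 'c) module_scheme \<Rightarrow> ('k, 'n, 'd) module_scheme
    \<Rightarrow> ('k, 'p, 'e) module_scheme
    \<Rightarrow> (('m \<times> 'n \<Rightarrow> 'k) set \<times> 'p \<Rightarrow> 'k) set \<Rightarrow> ('m \<times> ('n \<times> 'p \<Rightarrow> 'k) set \<Rightarrow> 'k) set"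
  where "tensor_assoc K M N P =
    (let NP = tensor_product K N P; R = tensor_product K M NP in
      tensor_lift K (tensor_product K M N) P R
        (\<lambda>T z. tensor_lift K M N R (\<lambda>x y. tensor K M NP x (tensor K N P y z)) T))"


section \<open>Cocommutative Hopf dialgebras\<close>

locale cocommutative_coalgebra =
  fixes K :: "('k, 'r) ring_scheme"
    and A :: "('k, 'a, 'c) module_scheme"
    and \<Delta> :: "'a \<Rightarrow> ('a \<times> 'a \<Rightarrow> 'k) set"
    and \<epsilon> :: "'a \<Rightarrow> 'k"
  assumes field: "field K"
    and module: "module K A"
    and comult_linear: "linear_map K A (tensor_product K A A) \<Delta>"
    and counit_linear: "linear_map K A (regular_module K) \<epsilon>"
    and coassoc: "a \<in> carrier A \<Longrightarrow>
      tensor_assoc K A A A (tensor_map K A A (tensor_product K A A) A \<Delta> (\<lambda>x. x) (\<Delta> a)) =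
      tensor_map K A A A (tensor_product K A A) (\<lambda>x. x) \<Delta> (\<Delta> a)"
    and counit_left: "a \<in> carrier A \<Longrightarrow> tensor_lift K A A A (\<lambda>x y. \<epsilon> x \<odot>\<^bsub>A\<^esub> y) (\<Delta> a) = a"
    and counit_right: "a \<in> carrier A \<Longrightarrow> tensor_lift K A A A (\<lambda>x y. \<epsilon> y \<odot>\<^bsub>A\<^esub> x) (\<Delta> a) = a"
    and cocommutative: "a \<in> carrier A \<Longrightarrow> tensor_swap K A A (\<Delta> a) = \<Delta> a"

text \<open>The Sweedler sum \<open>\<Sum> b(a\<^sub>1, a\<^sub>2)\<close> with values in \<open>P\<close>, for a bilinear map \<open>b\<close>.\<close>

definition sweedler ::
  "('k, 'r) ring_scheme \<Rightarrow> ('k, 'a, 'c) module_scheme \<Rightarrow> ('a \<Rightarrow> ('a \<times> 'a \<Rightarrow> 'k) set)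
    \<Rightarrow> ('k, 'p, 'e) module_scheme \<Rightarrow> ('a \<Rightarrow> 'a \<Rightarrow> 'p) \<Rightarrow> 'a \<Rightarrow> 'p"
  where "sweedler K A \<Delta> P b a = tensor_lift K A A P b (\<Delta> a)"

definition coalgebra_endomorphism ::
  "('k, 'r) ring_scheme \<Rightarrow> ('k, 'a, 'c) module_scheme \<Rightarrow> ('a \<Rightarrow> ('a \<times> 'a \<Rightarrow> 'k) set)
    \<Rightarrow> ('a \<Rightarrow> 'k) \<Rightarrow> ('a \<Rightarrow> 'a) \<Rightarrow> bool"
  where "coalgebra_endomorphism K A \<Delta> \<epsilon> f \<longleftrightarrow>
    linear_map K A A f \<and>
    (\<forall>a\<in>carrier A. \<Delta> (f a) = tensor_map K A A A A f f (\<Delta> a)) \<and>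
    (\<forall>a\<in>carrier A. \<epsilon> (f a) = \<epsilon> a)"

text \<open>A bilinear product \<open>m\<close> is a coalgebra morphism \<open>A \<otimes> A \<rightarrow> A\<close>; the nested Sweedler sum is
  \<open>\<Sum> (a\<^sub>1 m b\<^sub>1) \<otimes> (a\<^sub>2 m b\<^sub>2)\<close>.\<close>

definition coalgebra_product ::
  "('k, 'r) ring_scheme \<Rightarrow> ('k, 'a, 'c) module_scheme \<Rightarrow> ('a \<Rightarrow> ('a \<times> 'a \<Rightarrow> 'k) set)
    \<Rightarrow> ('a \<Rightarrow> 'k) \<Rightarrow> ('a \<Rightarrow> 'a \<Rightarrow> 'a) \<Rightarrow> bool"
  where "coalgebra_product K A \<Delta> \<epsilon> m \<longleftrightarrow>
    (\<forall>a\<in>carrier A. \<forall>b\<in>carrier A.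
      \<Delta> (m a b) =
        sweedler K A \<Delta> (tensor_product K A A)
          (\<lambda>a1 a2. sweedler K A \<Delta> (tensor_product K A A)
            (\<lambda>b1 b2. tensor K A A (m a1 b1) (m a2 b2)) b) a \<and>
      \<epsilon> (m a b) = \<epsilon> a \<otimes>\<^bsub>K\<^esub> \<epsilon> b)"

locale cocommutative_hopf_dialgebra = cocommutative_coalgebra K A \<Delta> \<epsilon>
  for K :: "('k, 'r) ring_scheme"
    and A :: "('k, 'a, 'c) module_scheme"
    and \<Delta> :: "'a \<Rightarrow> ('a \<times> 'a \<Rightarrow> 'k) set"
    and \<epsilon> :: "'a \<Rightarrow> 'k" +
  fixes \<xi> :: 'a
    and lprod :: "'a \<Rightarrow> 'a \<Rightarrow> 'a"  (infixl \<open>\<turnstile>\<close> 70)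
    and rprod :: "'a \<Rightarrow> 'a \<Rightarrow> 'a"  (infixl \<open>\<stileturn>\<close> 70)
    and S :: "'a \<Rightarrow> 'a"
  assumes unit_closed: "\<xi> \<in> carrier A"
    and lprod_bilinear: "bilinear_map K A A A (\<turnstile>)"
    and rprod_bilinear: "bilinear_map K A A A (\<stileturn>)"
    and antipode_morphism: "coalgebra_endomorphism K A \<Delta> \<epsilon> S"
    and lprod_assoc: "\<lbrakk>a \<in> carrier A; b \<in> carrier A; c \<in> carrier A\<rbrakk> \<Longrightarrow> (a \<turnstile> b) \<turnstile> c = a \<turnstile> (b \<turnstile> c)"
    and rprod_assoc: "\<lbrakk>a \<in> carrier A; b \<in> carrier A; c \<in> carrier A\<rbrakk> \<Longrightarrow> (a \<stileturn> b) \<stileturn> c = a \<stileturn> (b \<stileturn> c)"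
    and left_bar: "\<lbrakk>a \<in> carrier A; b \<in> carrier A; c \<in> carrier A\<rbrakk> \<Longrightarrow> (a \<turnstile> b) \<turnstile> c = (a \<stileturn> b) \<turnstile> c"
    and right_bar: "\<lbrakk>a \<in> carrier A; b \<in> carrier A; c \<in> carrier A\<rbrakk> \<Longrightarrow> a \<stileturn> (b \<stileturn> c) = a \<stileturn> (b \<turnstile> c)"
    and inner_assoc: "\<lbrakk>a \<in> carrier A; b \<in> carrier A; c \<in> carrier A\<rbrakk> \<Longrightarrow> (a \<turnstile> b) \<stileturn> c = a \<turnstile> (b \<stileturn> c)"
    and unit_lprod: "a \<in> carrier A \<Longrightarrow> \<xi> \<turnstile> a = a"
    and rprod_unit: "a \<in> carrier A \<Longrightarrow> a \<stileturn> \<xi> = a"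
    and unit_balanced: "a \<in> carrier A \<Longrightarrow> a \<turnstile> \<xi> = \<xi> \<stileturn> a"
    and unit_comult: "\<Delta> \<xi> = tensor K A A \<xi> \<xi>"
    and unit_counit: "\<epsilon> \<xi> = \<one>\<^bsub>K\<^esub>"
    and lprod_morphism: "coalgebra_product K A \<Delta> \<epsilon> (\<turnstile>)"
    and rprod_morphism: "coalgebra_product K A \<Delta> \<epsilon> (\<stileturn>)"
    and antipode_right: "a \<in> carrier A \<Longrightarrow> sweedler K A \<Delta> A (\<lambda>a1 a2. a1 \<turnstile> S a2) a = \<epsilon> a \<odot>\<^bsub>A\<^esub> \<xi>"
    and antipode_left: "a \<in> carrier A \<Longrightarrow> sweedler K A \<Delta> A (\<lambda>a1 a2. S a1 \<stileturn> a2) a = \<epsilon> a \<odot>\<^bsub>A\<^esub> \<xi>"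

definition glike ::
  "('k, 'r) ring_scheme \<Rightarrow> ('k, 'a, 'c) module_scheme \<Rightarrow> ('a \<Rightarrow> ('a \<times> 'a \<Rightarrow> 'k) set)
    \<Rightarrow> ('a \<Rightarrow> 'k) \<Rightarrow> 'a set"
  where "glike K A \<Delta> \<epsilon> = {g \<in> carrier A. \<Delta> g = tensor K A A g g \<and> \<epsilon> g = \<one>\<^bsub>K\<^esub>}"


section \<open>Digroups\<close>

definition bar_unit :: "'d set \<Rightarrow> ('d \<Rightarrow> 'd \<Rightarrow> 'd) \<Rightarrow> ('d \<Rightarrow> 'd \<Rightarrow> 'd) \<Rightarrow> 'd \<Rightarrow> bool"
  where "bar_unit D lprod rprod e \<longleftrightarrow>
    e \<in> D \<and> (\<forall>x\<in>D. rprod x e = x \<and> lprod e x = x)"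

locale generalized_digroup =
  fixes D :: "'d set"
    and lprod :: "'d \<Rightarrow> 'd \<Rightarrow> 'd"  (infixl \<open>\<turnstile>\<close> 70)
    and rprod :: "'d \<Rightarrow> 'd \<Rightarrow> 'd"  (infixl \<open>\<stileturn>\<close> 70)
  assumes nonempty: "D \<noteq> {}"
    and lprod_closed: "\<lbrakk>x \<in> D; y \<in> D\<rbrakk> \<Longrightarrow> x \<turnstile> y \<in> D"
    and rprod_closed: "\<lbrakk>x \<in> D; y \<in> D\<rbrakk> \<Longrightarrow> x \<stileturn> y \<in> D"
    and lprod_assoc: "\<lbrakk>x \<in> D; y \<in> D; z \<in> D\<rbrakk> \<Longrightarrow> (x \<turnstile> y) \<turnstile> z = x \<turnstile> (y \<turnstile> z)"
    and rprod_assoc: "\<lbrakk>x \<in> D; y \<in> D; z \<in> D\<rbrakk> \<Longrightarrow> (x \<stileturn> y) \<stileturn> z = x \<stileturn> (y \<stileturn> z)"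
    and inner_assoc: "\<lbrakk>x \<in> D; y \<in> D; z \<in> D\<rbrakk> \<Longrightarrow> x \<turnstile> (y \<stileturn> z) = (x \<turnstile> y) \<stileturn> z"
    and right_bar: "\<lbrakk>x \<in> D; y \<in> D; z \<in> D\<rbrakk> \<Longrightarrow> x \<stileturn> (y \<stileturn> z) = x \<stileturn> (y \<turnstile> z)"
    and left_bar: "\<lbrakk>x \<in> D; y \<in> D; z \<in> D\<rbrakk> \<Longrightarrow> (x \<turnstile> y) \<turnstile> z = (x \<stileturn> y) \<turnstile> z"
    and ex_bar_unit: "\<exists>e. bar_unit D (\<turnstile>) (\<stileturn>) e"
    and ex_right_inverse: "\<lbrakk>bar_unit D (\<turnstile>) (\<stileturn>) e; x \<in> D\<rbrakk> \<Longrightarrow> \<exists>y\<in>D. x \<turnstile> y = e"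
    and ex_left_inverse: "\<lbrakk>bar_unit D (\<turnstile>) (\<stileturn>) e; x \<in> D\<rbrakk> \<Longrightarrow> \<exists>y\<in>D. y \<stileturn> x = e"

definition digroup_inverse_of ::
  "'d set \<Rightarrow> ('d \<Rightarrow> 'd \<Rightarrow> 'd) \<Rightarrow> ('d \<Rightarrow> 'd \<Rightarrow> 'd) \<Rightarrow> 'd \<Rightarrow> 'd \<Rightarrow> 'd \<Rightarrow> bool"
  where "digroup_inverse_of D lprod rprod \<xi> x y \<longleftrightarrow>
    y \<in> D \<and> lprod x y = \<xi> \<and> rprod y x = \<xi>"

locale digroup = generalized_digroup D lprod rprod
  for D :: "'d set"
    and lprod :: "'d \<Rightarrow> 'd \<Rightarrow> 'd"  (infixl \<open>\<turnstile>\<close> 70)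
    and rprod :: "'d \<Rightarrow> 'd \<Rightarrow> 'd"  (infixl \<open>\<stileturn>\<close> 70) +
  fixes \<xi> :: 'd
  assumes distinguished_bar_unit: "bar_unit D (\<turnstile>) (\<stileturn>) \<xi>"
    and single_inverse: "x \<in> D \<Longrightarrow> \<exists>!y. digroup_inverse_of D (\<turnstile>) (\<stileturn>) \<xi> x y"

definition digroup_inverse ::
  "'d set \<Rightarrow> ('d \<Rightarrow> 'd \<Rightarrow> 'd) \<Rightarrow> ('d \<Rightarrow> 'd \<Rightarrow> 'd) \<Rightarrow> 'd \<Rightarrow> 'd \<Rightarrow> 'd"
  where "digroup_inverse D lprod rprod \<xi> x = (THE y. digroup_inverse_of D lprod rprod \<xi> x y)"

end

theory Submission
  imports Defs
begin

text \<open>For a bilinear map \<open>b\<close>, the linear extension of \<open>b\<close> to the free module kills the tensor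
  relations, so \<open>tensor_lift\<close> sends \<open>x \<otimes> y\<close> to \<open>b x y\<close>. On a group-like \<open>g\<close> every Sweedler sum
  therefore reduces to the single term \<open>b g g\<close>, and the Hopf dialgebra axioms become the digroup
  axioms. For a bar-unit \<open>e\<close> other than \<open>\<xi>\<close>, inverses of \<open>g\<close> are \<open>S g \<turnstile> e\<close> and \<open>e \<stileturn> S g\<close>. The
  inverse with respect to \<open>\<xi>\<close> is unique: from \<open>g \<turnstile> z = \<xi> = y \<stileturn> g\<close> one gets
  \<open>y = y \<stileturn> (g \<turnstile> z) = y \<stileturn> (g \<stileturn> z) = \<xi> \<stileturn> z = z \<turnstile> \<xi>\<close>, which does not depend on \<open>y\<close>.\<close>

section \<open>Linear maps, kernels and intersections of submodules\<close>

lemma linear_mapI: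
  assumes "\<And>x. x \<in> carrier M \<Longrightarrow> f x \<in> carrier N"
    and "\<And>x y. x \<in> carrier M \<Longrightarrow> y \<in> carrier M \<Longrightarrow> f (x \<oplus>\<^bsub>M\<^esub> y) = f x \<oplus>\<^bsub>N\<^esub> f y"
    and "\<And>c x. c \<in> carrier K \<Longrightarrow> x \<in> carrier M \<Longrightarrow> f (c \<odot>\<^bsub>M\<^esub> x) = c \<odot>\<^bsub>N\<^esub> f x"
  shows "linear_map K M N f"
  using assms unfolding linear_map_def by blast

lemma linear_mapD:
  assumes "linear_map K M N f"
  shows "x \<in> carrier M \<Longrightarrow> f x \<in> carrier N"
    and "x \<in> carrier M \<Longrightarrow> y \<in> carrier M \<Longrightarrow> f (x \<oplus>\<^bsub>M\<^esub> y) = f x \<oplus>\<^bsub>N\<^esub> f y"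
    and "c \<in> carrier K \<Longrightarrow> x \<in> carrier M \<Longrightarrow> f (c \<odot>\<^bsub>M\<^esub> x) = c \<odot>\<^bsub>N\<^esub> f x"
  using assms unfolding linear_map_def by blast+

lemma linear_map_zero:
  assumes M: "module K M" and N: "module K N" and f: "linear_map K M N f"
  shows "f \<zero>\<^bsub>M\<^esub> = \<zero>\<^bsub>N\<^esub>"
proof -
  interpret M: module K M by (rule M)
  interpret N: module K N by (rule N)
  have "f \<zero>\<^bsub>M\<^esub> = f (\<zero>\<^bsub>K\<^esub> \<odot>\<^bsub>M\<^esub> \<zero>\<^bsub>M\<^esub>)"
    by simp
  also have "\<dots> = \<zero>\<^bsub>K\<^esub> \<odot>\<^bsub>N\<^esub> f \<zero>\<^bsub>M\<^esub>"
    by (rule linear_mapD(3)[OF f]) simp_all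
  also have "\<dots> = \<zero>\<^bsub>N\<^esub>"
    by (simp add: linear_mapD(1)[OF f])
  finally show ?thesis .
qed

lemma linear_map_minus:
  assumes M: "module K M" and N: "module K N" and f: "linear_map K M N f"
    and x: "x \<in> carrier M"
  shows "f (\<ominus>\<^bsub>M\<^esub> x) = \<ominus>\<^bsub>N\<^esub> f x"
proof -
  interpret M: module K M by (rule M)
  interpret N: module K N by (rule N)
  have "f (\<ominus>\<^bsub>M\<^esub> x) \<oplus>\<^bsub>N\<^esub> f x = f (\<ominus>\<^bsub>M\<^esub> x \<oplus>\<^bsub>M\<^esub> x)"
    using x by (simp add: linear_mapD(2)[OF f])
  also have "\<dots> = \<zero>\<^bsub>N\<^esub>"
    using x linear_map_zero[OF M N f] by (simp add: M.l_neg)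
  finally show ?thesis
    using x by (simp add: linear_mapD(1)[OF f] N.minus_equality)
qed

lemma linear_map_diff:
  assumes M: "module K M" and N: "module K N" and f: "linear_map K M N f"
    and x: "x \<in> carrier M" and y: "y \<in> carrier M"
  shows "f (x \<ominus>\<^bsub>M\<^esub> y) = f x \<ominus>\<^bsub>N\<^esub> f y"
proof -
  interpret M: module K M by (rule M)
  show ?thesis
    using x y by (simp add: a_minus_def linear_mapD(2)[OF f] linear_map_minus[OF M N f])
qed

text \<open>Prepares the minimality argument for \<open>tensor_null\<close>: a linear map that kills
  the tensor relations has a kernel that is a submodule containing them, hence containing the whole
  hull.\<close>

lemma submodule_linear_kernel:
  assumes M: "module K M" and N: "module K N" and f: "linear_map K M N f"
  shows "submodule {x \<in> carrier M. f x = \<zero>\<^bsub>N\<^esub>} K M"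
proof -
  interpret M: module K M by (rule M)
  interpret N: module K N by (rule N)
  show ?thesis
    by (rule M.submoduleI)
      (auto simp: linear_map_zero[OF M N f] linear_map_minus[OF M N f] linear_mapD(2,3)[OF f])
qed

lemma submodule_Inter:
  assumes M: "module K M" and "\<H> \<noteq> {}" and H: "\<And>H. H \<in> \<H> \<Longrightarrow> submodule H K M"
  shows "submodule (\<Inter>\<H>) K M"
proof -
  interpret M: module K M by (rule M)
  have "subgroup (\<Inter>\<H>) (add_monoid M)"
    using assms(2) H by (intro group.subgroups_Inter[OF M.a_group]) (auto simp: submodule_def)
  moreover have "c \<odot>\<^bsub>M\<^esub> x \<in> \<Inter>\<H>" if "c \<in> carrier K" "x \<in> \<Inter>\<H>" for c x
    using that submodule.smult_closed[OF H] by blast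
  ultimately show ?thesis
    by (simp add: submodule_def submodule_axioms_def)
qed

text \<open>Makes the coset calculus for abelian groups available for the quotient by a
  submodule.\<close>

lemma submodule_imp_abelian_subgroup:
  assumes M: "module K M" and H: "submodule H K M"
  shows "abelian_subgroup H M"
proof -
  interpret M: module K M by (rule M)
  show ?thesis
    using H by (intro abelian_subgroupI3 additive_subgroupI M.abelian_group_axioms)
      (simp add: submodule_def)
qed


section \<open>Free modules\<close>

lemma free_module_simps:
  "f \<in> carrier (free_module K X) \<longleftrightarrow>
    (\<forall>x. f x \<in> carrier K) \<and> {x. f x \<noteq> \<zero>\<^bsub>K\<^esub>} \<subseteq> X \<and> finite {x. f x \<noteq> \<zero>\<^bsub>K\<^esub>}"
  "\<zero>\<^bsub>free_module K X\<^esub> = (\<lambda>x. \<zero>\<^bsub>K\<^esub>)"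
  "f \<oplus>\<^bsub>free_module K X\<^esub> g = (\<lambda>x. f x \<oplus>\<^bsub>K\<^esub> g x)"
  "c \<odot>\<^bsub>free_module K X\<^esub> f = (\<lambda>x. c \<otimes>\<^bsub>K\<^esub> f x)"
  by (simp_all add: free_module_def)

text \<open>The module laws hold pointwise in \<open>K\<close>. The point to check is that sums,
  multiples and negatives keep their supports finite and inside \<open>X\<close>.\<close>

lemma module_free_module:
  assumes "cring K"
  shows "module K (free_module K X)"
proof -
  interpret K: cring K by (rule assms)
  let ?F = "free_module K X"
  have add: "f \<oplus>\<^bsub>?F\<^esub> g \<in> carrier ?F" if "f \<in> carrier ?F" "g \<in> carrier ?F" for f g
  proof -
    have "{x. f x \<oplus>\<^bsub>K\<^esub> g x \<noteq> \<zero>\<^bsub>K\<^esub>} \<subseteq> {x. f x \<noteq> \<zero>\<^bsub>K\<^esub>} \<union> {x. g x \<noteq> \<zero>\<^bsub>K\<^esub>}"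
      by auto
    with that show ?thesis
      by (auto simp: free_module_simps intro: finite_subset)
  qed
  have smult: "c \<odot>\<^bsub>?F\<^esub> f \<in> carrier ?F" if "c \<in> carrier K" "f \<in> carrier ?F" for c f
  proof -
    have "{x. c \<otimes>\<^bsub>K\<^esub> f x \<noteq> \<zero>\<^bsub>K\<^esub>} \<subseteq> {x. f x \<noteq> \<zero>\<^bsub>K\<^esub>}"
      using that by auto
    with that show ?thesis
      by (auto simp: free_module_simps intro: finite_subset)
  qed
  have "abelian_group ?F"
  proof (rule abelian_groupI)
    fix f assume f: "f \<in> carrier ?F"
    have "{x. \<ominus>\<^bsub>K\<^esub> f x \<noteq> \<zero>\<^bsub>K\<^esub>} \<subseteq> {x. f x \<noteq> \<zero>\<^bsub>K\<^esub>}"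
      by auto
    with f have "(\<lambda>x. \<ominus>\<^bsub>K\<^esub> f x) \<in> carrier ?F"
      by (auto simp: free_module_simps intro: finite_subset)
    moreover have "(\<lambda>x. \<ominus>\<^bsub>K\<^esub> f x) \<oplus>\<^bsub>?F\<^esub> f = \<zero>\<^bsub>?F\<^esub>"
      using f by (simp add: free_module_simps K.l_neg)
    ultimately show "\<exists>g\<in>carrier ?F. g \<oplus>\<^bsub>?F\<^esub> f = \<zero>\<^bsub>?F\<^esub>"
      by blast
  qed (use add in \<open>auto simp: free_module_simps K.a_ac\<close>)
  then show ?thesis
    by (rule moduleI[OF assms])
      (use smult in \<open>auto simp: free_module_simps K.l_distr K.r_distr K.m_assoc\<close>)
qed

lemma free_gen_closed:
  assumes "cring K" "x \<in> X"
  shows "free_gen K x \<in> carrier (free_module K X)"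
proof -
  interpret K: cring K by (rule assms)
  have "{y. free_gen K x y \<noteq> \<zero>\<^bsub>K\<^esub>} \<subseteq> {x}"
    by (auto simp: free_gen_def)
  with assms(2) show ?thesis
    by (auto simp: free_module_simps free_gen_def intro: finite_subset)
qed

text \<open>The sum defining \<open>free_lift\<close> runs over the exact support, which changes
  with \<open>f\<close>. Outside the support the terms vanish, so any finite \<open>B\<close>
  between the support and \<open>X\<close> may serve as index set; \<open>B \<subseteq> X\<close>
  guarantees that the added values of \<open>g\<close> lie in \<open>P\<close>.\<close>

lemma free_lift_eq_finsum:
  assumes P: "module K P" and g: "\<And>x. x \<in> X \<Longrightarrow> g x \<in> carrier P"
    and f: "f \<in> carrier (free_module K X)"
    and B: "finite B" "{x. f x \<noteq> \<zero>\<^bsub>K\<^esub>} \<subseteq> B" "B \<subseteq> X"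
  shows "free_lift K P g f = (\<Oplus>\<^bsub>P\<^esub>x\<in>B. f x \<odot>\<^bsub>P\<^esub> g x)"
proof -
  interpret P: module K P by (rule P)
  show ?thesis
    unfolding free_lift_def
    by (rule P.add.finprod_mono_neutral_cong_left) (use assms in \<open>auto simp: free_module_simps\<close>)
qed

lemma linear_map_free_lift:
  assumes P: "module K P" and g: "\<And>x. x \<in> X \<Longrightarrow> g x \<in> carrier P"
  shows "linear_map K (free_module K X) P (free_lift K P g)"
proof -
  interpret P: module K P by (rule P)
  interpret F: module K "free_module K X" by (rule module_free_module[OF P.R.cring_axioms])
  let ?F = "free_module K X"
  have eq: "free_lift K P g f = (\<Oplus>\<^bsub>P\<^esub>x\<in>B. f x \<odot>\<^bsub>P\<^esub> g x)"
    if "f \<in> carrier ?F" "finite B" "{x. f x \<noteq> \<zero>\<^bsub>K\<^esub>} \<subseteq> B" "B \<subseteq> X" for f B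
    using free_lift_eq_finsum[OF P _ that] g by blast
  have summand: "(\<lambda>x. f x \<odot>\<^bsub>P\<^esub> g x) \<in> B \<rightarrow> carrier P"
    if "f \<in> carrier ?F" "B \<subseteq> X" for f B
    using that g by (auto simp: free_module_simps)
  show ?thesis
  proof (rule linear_mapI)
    fix f assume f: "f \<in> carrier ?F"
    then show "free_lift K P g f \<in> carrier P"
      unfolding free_lift_def
      by (intro P.finsum_closed summand) (auto simp: free_module_simps)
  next
    fix f h assume f: "f \<in> carrier ?F" and h: "h \<in> carrier ?F"
    \<comment> \<open>Cancellation can shrink the support of the sum, so all three values are
      written as sums over the union of the supports.\<close>
    let ?B = "{x. f x \<noteq> \<zero>\<^bsub>K\<^esub>} \<union> {x. h x \<noteq> \<zero>\<^bsub>K\<^esub>}"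
    have B: "finite ?B" "?B \<subseteq> X"
      using f h by (auto simp: free_module_simps)
    have supp: "{x. (f \<oplus>\<^bsub>?F\<^esub> h) x \<noteq> \<zero>\<^bsub>K\<^esub>} \<subseteq> ?B"
      by (auto simp: free_module_simps)
    have "free_lift K P g (f \<oplus>\<^bsub>?F\<^esub> h) = (\<Oplus>\<^bsub>P\<^esub>x\<in>?B. (f \<oplus>\<^bsub>?F\<^esub> h) x \<odot>\<^bsub>P\<^esub> g x)"
      by (rule eq[OF F.add.m_closed[OF f h] B(1) supp B(2)])
    also have "\<dots> = (\<Oplus>\<^bsub>P\<^esub>x\<in>?B. f x \<odot>\<^bsub>P\<^esub> g x \<oplus>\<^bsub>P\<^esub> h x \<odot>\<^bsub>P\<^esub> g x)"
    proof (rule P.finsum_cong')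
      show "(\<lambda>x. f x \<odot>\<^bsub>P\<^esub> g x \<oplus>\<^bsub>P\<^esub> h x \<odot>\<^bsub>P\<^esub> g x) \<in> ?B \<rightarrow> carrier P"
        using summand[OF f B(2)] summand[OF h B(2)] by (auto simp del: Un_iff)
      fix x assume "x \<in> ?B"
      with B(2) have "x \<in> X" by blast
      with f h g show "(f \<oplus>\<^bsub>?F\<^esub> h) x \<odot>\<^bsub>P\<^esub> g x = f x \<odot>\<^bsub>P\<^esub> g x \<oplus>\<^bsub>P\<^esub> h x \<odot>\<^bsub>P\<^esub> g x"
        by (simp add: free_module_simps P.smult_l_distr)
    qed simp
    also have "\<dots> = free_lift K P g f \<oplus>\<^bsub>P\<^esub> free_lift K P g h"
    proof -
      have "free_lift K P g f = (\<Oplus>\<^bsub>P\<^esub>x\<in>?B. f x \<odot>\<^bsub>P\<^esub> g x)"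
        by (rule eq[OF f B(1) _ B(2)]) simp
      moreover have "free_lift K P g h = (\<Oplus>\<^bsub>P\<^esub>x\<in>?B. h x \<odot>\<^bsub>P\<^esub> g x)"
        by (rule eq[OF h B(1) _ B(2)]) simp
      ultimately show ?thesis
        using P.finsum_addf[OF summand[OF f B(2)] summand[OF h B(2)]] by simp
    qed
    finally show "free_lift K P g (f \<oplus>\<^bsub>?F\<^esub> h) = free_lift K P g f \<oplus>\<^bsub>P\<^esub> free_lift K P g h" .
  next
    fix c f assume c: "c \<in> carrier K" and f: "f \<in> carrier ?F"
    \<comment> \<open>The support of the multiple may be smaller than that of \<open>f\<close>, for
      instance when \<open>c\<close> is zero; the larger support of \<open>f\<close> indexes both
      sides.\<close>
    let ?B = "{x. f x \<noteq> \<zero>\<^bsub>K\<^esub>}"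
    have B: "finite ?B" "?B \<subseteq> X"
      using f by (auto simp: free_module_simps)
    have supp: "{x. (c \<odot>\<^bsub>?F\<^esub> f) x \<noteq> \<zero>\<^bsub>K\<^esub>} \<subseteq> ?B"
      using c by (auto simp: free_module_simps)
    have "free_lift K P g (c \<odot>\<^bsub>?F\<^esub> f) = (\<Oplus>\<^bsub>P\<^esub>x\<in>?B. (c \<odot>\<^bsub>?F\<^esub> f) x \<odot>\<^bsub>P\<^esub> g x)"
      by (rule eq[OF F.smult_closed[OF c f] B(1) supp B(2)])
    also have "\<dots> = (\<Oplus>\<^bsub>P\<^esub>x\<in>?B. c \<odot>\<^bsub>P\<^esub> (f x \<odot>\<^bsub>P\<^esub> g x))"
    proof (rule P.finsum_cong')
      show "(\<lambda>x. c \<odot>\<^bsub>P\<^esub> (f x \<odot>\<^bsub>P\<^esub> g x)) \<in> ?B \<rightarrow> carrier P"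
        using c summand[OF f B(2)] by auto
      fix x assume "x \<in> ?B"
      with B(2) have "x \<in> X" by blast
      with c f g show "(c \<odot>\<^bsub>?F\<^esub> f) x \<odot>\<^bsub>P\<^esub> g x = c \<odot>\<^bsub>P\<^esub> (f x \<odot>\<^bsub>P\<^esub> g x)"
        by (simp add: free_module_simps P.smult_assoc1)
    qed simp
    also have "\<dots> = c \<odot>\<^bsub>P\<^esub> free_lift K P g f"
      unfolding free_lift_def
      by (rule P.finsum_smult_ldistr[symmetric, OF B(1) c summand[OF f B(2)]])
    finally show "free_lift K P g (c \<odot>\<^bsub>?F\<^esub> f) = c \<odot>\<^bsub>P\<^esub> free_lift K P g f" .
  qed
qed

lemma free_lift_free_gen:
  assumes P: "module K P" and g: "g x \<in> carrier P"
  shows "free_lift K P g (free_gen K x) = g x"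
proof -
  interpret P: module K P by (rule P)
  have "free_lift K P g (free_gen K x) = (\<Oplus>\<^bsub>P\<^esub>y\<in>{x}. free_gen K x y \<odot>\<^bsub>P\<^esub> g y)"
    \<comment> \<open>With \<open>{x}\<close> as generating set, \<open>g x\<close> is the only
      value that must lie in \<open>P\<close>.\<close>
    by (rule free_lift_eq_finsum[where X = "{x}"])
      (use g in \<open>auto simp: P free_gen_closed[OF P.R.cring_axioms], auto simp: free_gen_def split: if_splits\<close>)
  also have "\<dots> = g x"
    using g by (simp add: free_gen_def)
  finally show ?thesis .
qed


section \<open>Quotient modules\<close>

lemma quotient_module_simps:
  "carrier (quotient_module M N) = a_rcosets\<^bsub>M\<^esub> N"
  "\<zero>\<^bsub>quotient_module M N\<^esub> = N"
  "X \<oplus>\<^bsub>quotient_module M N\<^esub> Y = X <+>\<^bsub>M\<^esub> Y"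
  "c \<odot>\<^bsub>quotient_module M N\<^esub> X = (\<Union>x\<in>X. N +>\<^bsub>M\<^esub> (c \<odot>\<^bsub>M\<^esub> x))"
  by (simp_all add: quotient_module_def)

context
  fixes K :: "('k, 'r) ring_scheme" and M :: "('k, 'm, 'c) module_scheme" and N :: "'m set"
  assumes M: "module K M" and N: "submodule N K M"
begin

interpretation M: module K M by (rule M)
interpretation N: abelian_subgroup N M by (rule submodule_imp_abelian_subgroup[OF M N])

lemma coset_closed: "x \<in> carrier M \<Longrightarrow> N +>\<^bsub>M\<^esub> x \<in> carrier (quotient_module M N)"
  by (simp add: quotient_module_simps M.a_rcosetsI N.a_subset)

lemma coset_eqI:
  assumes x: "x \<in> carrier M" and y: "y \<in> carrier M" and "x \<ominus>\<^bsub>M\<^esub> y \<in> N"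
  shows "N +>\<^bsub>M\<^esub> x = N +>\<^bsub>M\<^esub> y"
  using assms N.a_repr_independence'[OF N.a_rcos_module_rev[OF y x]] by (simp add: a_minus_def)

lemma coset_add:
  "x \<in> carrier M \<Longrightarrow> y \<in> carrier M \<Longrightarrow>
    (N +>\<^bsub>M\<^esub> x) \<oplus>\<^bsub>quotient_module M N\<^esub> (N +>\<^bsub>M\<^esub> y) = N +>\<^bsub>M\<^esub> (x \<oplus>\<^bsub>M\<^esub> y)"
  by (simp add: quotient_module_simps N.a_rcos_sum)

text \<open>The union defining the scalar multiple has equal members: if \<open>y\<close> is in the
  coset of \<open>x\<close>, then c y - c x = c (y - x) lies in \<open>N\<close>. As
  \<open>x\<close> is in its own coset, the index set is nonempty and the union is that one
  coset.\<close>

lemma coset_smult: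
  assumes c: "c \<in> carrier K" and x: "x \<in> carrier M"
  shows "c \<odot>\<^bsub>quotient_module M N\<^esub> (N +>\<^bsub>M\<^esub> x) = N +>\<^bsub>M\<^esub> (c \<odot>\<^bsub>M\<^esub> x)"
proof -
  have "N +>\<^bsub>M\<^esub> (c \<odot>\<^bsub>M\<^esub> y) = N +>\<^bsub>M\<^esub> (c \<odot>\<^bsub>M\<^esub> x)" if y: "y \<in> N +>\<^bsub>M\<^esub> x" for y
  proof (rule coset_eqI)
    have yM: "y \<in> carrier M"
      using y x by (rule N.a_elemrcos_carrier[rotated])
    then show "c \<odot>\<^bsub>M\<^esub> y \<in> carrier M" and "c \<odot>\<^bsub>M\<^esub> x \<in> carrier M"
      using c x by simp_all
    have "c \<odot>\<^bsub>M\<^esub> (y \<oplus>\<^bsub>M\<^esub> \<ominus>\<^bsub>M\<^esub> x) \<in> N"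
      using N.a_rcos_module_imp[OF x y] by (rule submodule.smult_closed[OF N c])
    then show "c \<odot>\<^bsub>M\<^esub> y \<ominus>\<^bsub>M\<^esub> c \<odot>\<^bsub>M\<^esub> x \<in> N"
      using c x yM by (simp add: a_minus_def M.smult_r_distr M.smult_r_minus)
  qed
  then have "(\<Union>y\<in>N +>\<^bsub>M\<^esub> x. N +>\<^bsub>M\<^esub> (c \<odot>\<^bsub>M\<^esub> y)) = N +>\<^bsub>M\<^esub> (c \<odot>\<^bsub>M\<^esub> x)"
    using N.a_rcos_self[OF x] by blast
  then show ?thesis
    by (simp only: quotient_module_simps)
qed

lemma carrier_quotient_module:
  "carrier (quotient_module M N) = (\<lambda>x. N +>\<^bsub>M\<^esub> x) ` carrier M"
  by (auto simp: quotient_module_simps A_RCOSETS_def')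

text \<open>Every coset has a representative in \<open>M\<close>, and \<open>coset_add\<close> and
  \<open>coset_smult\<close> compute with representatives, so each law descends from
  \<open>M\<close>.\<close>

lemma module_quotient_module: "module K (quotient_module M N)"
proof -
  let ?Q = "quotient_module M N"
  \<comment> \<open>The zero of the quotient is the bare set \<open>N\<close>; as the coset of zero
    it fits the same rules as the other elements.\<close>
  have zero: "\<zero>\<^bsub>?Q\<^esub> = N +>\<^bsub>M\<^esub> \<zero>\<^bsub>M\<^esub>"
    by (simp add: quotient_module_simps N.a_subset)
  have "abelian_group ?Q"
  proof (rule abelian_groupI; (unfold carrier_quotient_module zero)?)
    fix X assume "X \<in> (\<lambda>x. N +>\<^bsub>M\<^esub> x) ` carrier M"
    then obtain x where x: "x \<in> carrier M" "X = N +>\<^bsub>M\<^esub> x"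
      by blast
    then have "(N +>\<^bsub>M\<^esub> (\<ominus>\<^bsub>M\<^esub> x)) \<oplus>\<^bsub>?Q\<^esub> X = N +>\<^bsub>M\<^esub> \<zero>\<^bsub>M\<^esub>"
      by (simp add: coset_add M.l_neg)
    then show "\<exists>Y\<in>(\<lambda>x. N +>\<^bsub>M\<^esub> x) ` carrier M. Y \<oplus>\<^bsub>?Q\<^esub> X = N +>\<^bsub>M\<^esub> \<zero>\<^bsub>M\<^esub>"
      using x(1) by blast
  next
    fix X Y assume "X \<in> (\<lambda>x. N +>\<^bsub>M\<^esub> x) ` carrier M" "Y \<in> (\<lambda>x. N +>\<^bsub>M\<^esub> x) ` carrier M"
    then show "X \<oplus>\<^bsub>?Q\<^esub> Y = Y \<oplus>\<^bsub>?Q\<^esub> X"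
      by (elim imageE) (simp add: coset_add M.a_comm)
  qed ((elim imageE)?, simp add: coset_add M.a_assoc)+
  then show ?thesis
    by (rule moduleI[OF M.R.cring_axioms]; (unfold carrier_quotient_module)?)
      ((elim imageE)?, simp add: coset_add coset_smult M.smult_l_distr M.smult_r_distr M.smult_assoc1)+
qed

end


section \<open>Tensor products\<close>

lemma bilinear_mapD:
  assumes "bilinear_map K M N P b" "x \<in> carrier M" "y \<in> carrier N"
  shows "b x y \<in> carrier P"
    and "x' \<in> carrier M \<Longrightarrow> b (x \<oplus>\<^bsub>M\<^esub> x') y = b x y \<oplus>\<^bsub>P\<^esub> b x' y"
    and "y' \<in> carrier N \<Longrightarrow> b x (y \<oplus>\<^bsub>N\<^esub> y') = b x y \<oplus>\<^bsub>P\<^esub> b x y'"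
    and "c \<in> carrier K \<Longrightarrow> b (c \<odot>\<^bsub>M\<^esub> x) y = c \<odot>\<^bsub>P\<^esub> b x y"
    and "c \<in> carrier K \<Longrightarrow> b x (c \<odot>\<^bsub>N\<^esub> y) = c \<odot>\<^bsub>P\<^esub> b x y"
proof -
  have "linear_map K N P (b x)" "linear_map K M P (\<lambda>x. b x y)"
    using assms by (simp_all add: bilinear_map_def)
  note left = linear_mapD[OF this(1)] and right = linear_mapD[OF this(2)]
  show "b x y \<in> carrier P"
    and "x' \<in> carrier M \<Longrightarrow> b (x \<oplus>\<^bsub>M\<^esub> x') y = b x y \<oplus>\<^bsub>P\<^esub> b x' y"
    and "y' \<in> carrier N \<Longrightarrow> b x (y \<oplus>\<^bsub>N\<^esub> y') = b x y \<oplus>\<^bsub>P\<^esub> b x y'"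
    and "c \<in> carrier K \<Longrightarrow> b (c \<odot>\<^bsub>M\<^esub> x) y = c \<odot>\<^bsub>P\<^esub> b x y"
    and "c \<in> carrier K \<Longrightarrow> b x (c \<odot>\<^bsub>N\<^esub> y) = c \<odot>\<^bsub>P\<^esub> b x y"
    using assms(2,3) by (simp_all add: left right)
qed

lemma bilinear_mapI:
  assumes "\<And>x y. x \<in> carrier M \<Longrightarrow> y \<in> carrier N \<Longrightarrow> b x y \<in> carrier P"
    and "\<And>x x' y. x \<in> carrier M \<Longrightarrow> x' \<in> carrier M \<Longrightarrow> y \<in> carrier N \<Longrightarrow>
      b (x \<oplus>\<^bsub>M\<^esub> x') y = b x y \<oplus>\<^bsub>P\<^esub> b x' y"
    and "\<And>x y y'. x \<in> carrier M \<Longrightarrow> y \<in> carrier N \<Longrightarrow> y' \<in> carrier N \<Longrightarrow>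
      b x (y \<oplus>\<^bsub>N\<^esub> y') = b x y \<oplus>\<^bsub>P\<^esub> b x y'"
    and "\<And>c x y. c \<in> carrier K \<Longrightarrow> x \<in> carrier M \<Longrightarrow> y \<in> carrier N \<Longrightarrow>
      b (c \<odot>\<^bsub>M\<^esub> x) y = c \<odot>\<^bsub>P\<^esub> b x y"
    and "\<And>c x y. c \<in> carrier K \<Longrightarrow> x \<in> carrier M \<Longrightarrow> y \<in> carrier N \<Longrightarrow>
      b x (c \<odot>\<^bsub>N\<^esub> y) = c \<odot>\<^bsub>P\<^esub> b x y"
  shows "bilinear_map K M N P b"
  using assms unfolding bilinear_map_def by (auto intro!: linear_mapI)

text \<open>Supplies the bilinearity of the terms in the Sweedler sums of the antipode and
  coalgebra-morphism axioms.\<close>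

lemma bilinear_map_compose:
  assumes "bilinear_map K M' N' P b" and f: "linear_map K M M' f" and g: "linear_map K N N' g"
  shows "bilinear_map K M N P (\<lambda>x y. b (f x) (g y))"
  by (rule bilinear_mapI) (simp_all add: linear_mapD[OF f] linear_mapD[OF g] bilinear_mapD[OF assms(1)])

lemma linear_map_id: "linear_map K M M (\<lambda>x. x)"
  by (simp add: linear_map_def)

section \<open>The tensor product and the induced map on pure tensors\<close>

context
  fixes K :: "('k, 'r) ring_scheme"
    and M :: "('k, 'm, 'c) module_scheme" and N :: "('k, 'n, 'd) module_scheme"
  assumes M: "module K M" and N: "module K N"
begin

interpretation M: module K M by (rule M)
interpretation N: module K N by (rule N)

abbreviation (input) "free_pairs \<equiv> free_module K (carrier M \<times> carrier N)"

lemma module_free_pairs: "module K free_pairs"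
  by (rule module_free_module[OF M.R.cring_axioms])

interpretation F: module K free_pairs by (rule module_free_pairs)

lemma gen_pair_closed: "x \<in> carrier M \<Longrightarrow> y \<in> carrier N \<Longrightarrow> free_gen K (x, y) \<in> carrier free_pairs"
  by (simp add: free_gen_closed[OF M.R.cring_axioms])

lemma tensor_relationsI:
  assumes "x \<in> carrier M" "y \<in> carrier N"
  shows "x' \<in> carrier M \<Longrightarrow> free_gen K (x \<oplus>\<^bsub>M\<^esub> x', y) \<ominus>\<^bsub>free_pairs\<^esub> (free_gen K (x, y) \<oplus>\<^bsub>free_pairs\<^esub> free_gen K (x', y))
      \<in> tensor_relations K M N"
    and "y' \<in> carrier N \<Longrightarrow> free_gen K (x, y \<oplus>\<^bsub>N\<^esub> y') \<ominus>\<^bsub>free_pairs\<^esub> (free_gen K (x, y) \<oplus>\<^bsub>free_pairs\<^esub> free_gen K (x, y'))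
      \<in> tensor_relations K M N"
    and "c \<in> carrier K \<Longrightarrow> free_gen K (c \<odot>\<^bsub>M\<^esub> x, y) \<ominus>\<^bsub>free_pairs\<^esub> c \<odot>\<^bsub>free_pairs\<^esub> free_gen K (x, y) \<in> tensor_relations K M N"
    and "c \<in> carrier K \<Longrightarrow> free_gen K (x, c \<odot>\<^bsub>N\<^esub> y) \<ominus>\<^bsub>free_pairs\<^esub> c \<odot>\<^bsub>free_pairs\<^esub> free_gen K (x, y) \<in> tensor_relations K M N"
  using assms unfolding tensor_relations_def Let_def by blast+

lemma tensor_relations_cases:
  assumes "r \<in> tensor_relations K M N"
  obtains x x' y where "x \<in> carrier M" "x' \<in> carrier M" "y \<in> carrier N"
      "r = free_gen K (x \<oplus>\<^bsub>M\<^esub> x', y) \<ominus>\<^bsub>free_pairs\<^esub> (free_gen K (x, y) \<oplus>\<^bsub>free_pairs\<^esub> free_gen K (x', y))"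
    | x y y' where "x \<in> carrier M" "y \<in> carrier N" "y' \<in> carrier N"
      "r = free_gen K (x, y \<oplus>\<^bsub>N\<^esub> y') \<ominus>\<^bsub>free_pairs\<^esub> (free_gen K (x, y) \<oplus>\<^bsub>free_pairs\<^esub> free_gen K (x, y'))"
    | c x y where "c \<in> carrier K" "x \<in> carrier M" "y \<in> carrier N"
      "r = free_gen K (c \<odot>\<^bsub>M\<^esub> x, y) \<ominus>\<^bsub>free_pairs\<^esub> c \<odot>\<^bsub>free_pairs\<^esub> free_gen K (x, y)"
    | c x y where "c \<in> carrier K" "x \<in> carrier M" "y \<in> carrier N"
      "r = free_gen K (x, c \<odot>\<^bsub>N\<^esub> y) \<ominus>\<^bsub>free_pairs\<^esub> c \<odot>\<^bsub>free_pairs\<^esub> free_gen K (x, y)"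
  using assms unfolding tensor_relations_def Let_def
  by (elim UnE CollectE exE conjE) (rule that(1) that(2) that(3) that(4); assumption)+

lemma tensor_relations_subset: "tensor_relations K M N \<subseteq> carrier free_pairs"
proof
  fix r assume "r \<in> tensor_relations K M N"
  then show "r \<in> carrier free_pairs"
    by (cases rule: tensor_relations_cases) (simp_all add: gen_pair_closed)
qed

lemma submodule_tensor_null: "submodule (tensor_null K M N) K free_pairs"
  unfolding tensor_null_def hull_def
  \<comment> \<open>The hull intersects all submodules containing the relations; the free module
    itself is one of them, so the family is nonempty.\<close>
  by (rule submodule_Inter[OF module_free_pairs])
    (use F.carrier_is_submodule tensor_relations_subset in auto)

lemma module_tensor_product: "module K (tensor_product K M N)"
  unfolding tensor_product_def by (rule module_quotient_module[OF module_free_pairs submodule_tensor_null])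

text \<open>Each family of relations yields one law: the representatives of the two sides differ by
  a relation, which lies in \<open>tensor_null\<close>, so their cosets coincide.\<close>

lemma bilinear_map_tensor: "bilinear_map K M N (tensor_product K M N) (tensor K M N)"
proof -
  note Q = module_free_pairs submodule_tensor_null
  have eqI: "tensor_null K M N +>\<^bsub>free_pairs\<^esub> f = tensor_null K M N +>\<^bsub>free_pairs\<^esub> h"
    if "f \<ominus>\<^bsub>free_pairs\<^esub> h \<in> tensor_relations K M N" "f \<in> carrier free_pairs" "h \<in> carrier free_pairs" for f h
    using that by (intro coset_eqI[OF Q]) (auto simp: tensor_null_def hull_inc)
  show ?thesis
    unfolding tensor_product_def tensor_def
    by (rule bilinear_mapI)
      (simp_all add: coset_closed[OF Q] coset_add[OF Q] coset_smult[OF Q] gen_pair_closed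
        eqI[OF tensor_relationsI(1)] eqI[OF tensor_relationsI(2)]
        eqI[OF tensor_relationsI(3)] eqI[OF tensor_relationsI(4)])
qed

text \<open>Since \<open>tensor_lift\<close> is \<open>the_elem\<close> of an image, the image of
  the coset under the linear extension \<open>?L\<close> has to be shown to be a singleton.\<close>

lemma tensor_lift_tensor:
  fixes P :: "('k, 'p, 'e) module_scheme"
  assumes P: "module K P" and b: "bilinear_map K M N P b"
    and x: "x \<in> carrier M" and y: "y \<in> carrier N"
  shows "tensor_lift K M N P b (tensor K M N x y) = b x y"
proof -
  interpret P: module K P by (rule P)
  let ?L = "free_lift K P (\<lambda>(x, y). b x y)"
  have L: "linear_map K free_pairs P ?L"
    by (rule linear_map_free_lift[OF P]) (auto simp: bilinear_mapD(1)[OF b])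
  have gen: "?L (free_gen K (u, v)) = b u v" if "u \<in> carrier M" "v \<in> carrier N" for u v
    using free_lift_free_gen[OF P, of "\<lambda>(x, y). b x y" "(u, v)"] bilinear_mapD(1)[OF b that] by simp
  have "tensor_relations K M N \<subseteq> {f \<in> carrier free_pairs. ?L f = \<zero>\<^bsub>P\<^esub>}"
  proof
    fix r assume "r \<in> tensor_relations K M N"
    \<comment> \<open>Bilinearity of \<open>b\<close> turns the image of every relation into a
      difference \<open>p \<ominus> p\<close>.\<close>
    have "p \<ominus>\<^bsub>P\<^esub> p = \<zero>\<^bsub>P\<^esub>" if "p \<in> carrier P" for p
      using that by (simp add: a_minus_def P.r_neg)
    with \<open>r \<in> _\<close> have "?L r = \<zero>\<^bsub>P\<^esub>"
      by (cases rule: tensor_relations_cases)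
        (simp_all add: linear_map_diff[OF module_free_pairs P L] linear_mapD[OF L] gen gen_pair_closed
          bilinear_mapD[OF b])
    with \<open>r \<in> _\<close> show "r \<in> {f \<in> carrier free_pairs. ?L f = \<zero>\<^bsub>P\<^esub>}"
      using tensor_relations_subset by blast
  qed
  \<comment> \<open>\<open>tensor_null\<close> is the least submodule containing the relations, and
    the kernel of \<open>?L\<close> is such a submodule.\<close>
  then have null: "tensor_null K M N \<subseteq> {f \<in> carrier free_pairs. ?L f = \<zero>\<^bsub>P\<^esub>}"
    unfolding tensor_null_def by (rule hull_minimal) (rule submodule_linear_kernel[OF module_free_pairs P L])
  \<comment> \<open>The elements of the coset are the generator plus some \<open>n\<close> in
    \<open>tensor_null\<close>, and \<open>n\<close> contributes zero.\<close>
  have "?L (n \<oplus>\<^bsub>free_pairs\<^esub> free_gen K (x, y)) = b x y" if "n \<in> tensor_null K M N" for n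
    using that null x y bilinear_mapD(1)[OF b x y]
    by (auto simp: linear_mapD(2)[OF L] gen gen_pair_closed)
  \<comment> \<open>An empty coset would have an empty image, not a singleton.\<close>
  moreover have "tensor_null K M N \<noteq> {}"
    using F.submoduleE(2)[OF submodule_tensor_null] .
  ultimately have "?L ` tensor K M N x y = {b x y}"
    unfolding tensor_def a_r_coset_def' by (auto simp: image_iff)
  then show ?thesis
    by (simp add: tensor_lift_def)
qed

end


section \<open>Group-like elements\<close>

context cocommutative_hopf_dialgebra
begin

lemma glikeD:
  assumes "g \<in> glike K A \<Delta> \<epsilon>"
  shows "g \<in> carrier A" "\<Delta> g = tensor K A A g g" "\<epsilon> g = \<one>\<^bsub>K\<^esub>"
  using assms by (auto simp: glike_def)

text \<open>Here \<open>\<Delta> g\<close> is a single pure tensor, so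
  \<open>tensor_lift_tensor\<close> applies directly.\<close>

lemma sweedler_glike:
  assumes "g \<in> glike K A \<Delta> \<epsilon>" "module K P" "bilinear_map K A A P b"
  shows "sweedler K A \<Delta> P b g = b g g"
  using assms by (simp add: sweedler_def glikeD tensor_lift_tensor[OF module module])

text \<open>Stated for an arbitrary \<open>m\<close> so that both products are instances. The nested
  Sweedler sum is evaluated from the inside: first at \<open>h\<close> with \<open>a1\<close> and
  \<open>a2\<close> fixed, then at \<open>g\<close>.\<close>

lemma glike_product:
  assumes m: "bilinear_map K A A A m" and morph: "coalgebra_product K A \<Delta> \<epsilon> m"
    and g: "g \<in> glike K A \<Delta> \<epsilon>" and h: "h \<in> glike K A \<Delta> \<epsilon>"
  shows "m g h \<in> glike K A \<Delta> \<epsilon>"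
proof -
  interpret A: module K A by (rule module)
  note T = module_tensor_product[OF module module] bilinear_map_tensor[OF module module]
  note gA = glikeD(1)[OF g] and hA = glikeD(1)[OF h]
  have left: "linear_map K A A (m a)" if "a \<in> carrier A" for a
    using m that by (simp add: bilinear_map_def)
  have right: "linear_map K A A (\<lambda>a. m a b)" if "b \<in> carrier A" for b
    using m that by (simp add: bilinear_map_def)
  have inner: "sweedler K A \<Delta> (tensor_product K A A) (\<lambda>b1 b2. tensor K A A (m a1 b1) (m a2 b2)) h
      = tensor K A A (m a1 h) (m a2 h)" if "a1 \<in> carrier A" "a2 \<in> carrier A" for a1 a2
    by (rule sweedler_glike[OF h T(1)]) (rule bilinear_map_compose[OF T(2) left left]; fact that)
  \<comment> \<open>By \<open>inner\<close>, this map agrees with a bilinear one for arguments in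
    \<open>A\<close>. Agreement is known only there, so bilinearity is transferred law by law
    instead of by equality of functions.\<close>
  have outer: "bilinear_map K A A (tensor_product K A A) (\<lambda>a1 a2.
      sweedler K A \<Delta> (tensor_product K A A) (\<lambda>b1 b2. tensor K A A (m a1 b1) (m a2 b2)) h)"
  proof -
    have "bilinear_map K A A (tensor_product K A A) (\<lambda>a1 a2. tensor K A A (m a1 h) (m a2 h))"
      by (rule bilinear_map_compose[OF T(2) right right]; fact hA)
    from bilinear_mapD[OF this] show ?thesis
      by (intro bilinear_mapI) (simp_all add: inner)
  qed
  have "\<Delta> (m g h) = tensor K A A (m g h) (m g h)"
    using morph gA hA by (simp add: coalgebra_product_def sweedler_glike[OF g T(1) outer] inner)
  moreover have "\<epsilon> (m g h) = \<one>\<^bsub>K\<^esub>"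
    using morph gA hA by (simp add: coalgebra_product_def glikeD(3)[OF g] glikeD(3)[OF h])
  moreover have "m g h \<in> carrier A"
    by (rule bilinear_mapD(1)[OF m gA hA])
  ultimately show ?thesis
    by (simp add: glike_def)
qed

lemmas glike_lprod = glike_product[OF lprod_bilinear lprod_morphism]
lemmas glike_rprod = glike_product[OF rprod_bilinear rprod_morphism]

lemma antipode_linear: "linear_map K A A S"
  using antipode_morphism by (simp add: coalgebra_endomorphism_def)

text \<open>A coalgebra morphism preserves group-likes: S \<otimes> S sends the pure tensor of
  \<open>g\<close> with itself to that of \<open>S g\<close> with itself, and \<open>S\<close>
  preserves the counit.\<close>

lemma glike_antipode:
  assumes g: "g \<in> glike K A \<Delta> \<epsilon>"
  shows "S g \<in> glike K A \<Delta> \<epsilon>"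
proof -
  note gA = glikeD(1)[OF g]
  have "tensor_map K A A A A S S (tensor K A A g g) = tensor K A A (S g) (S g)"
    unfolding tensor_map_def
    by (rule tensor_lift_tensor[OF module module module_tensor_product[OF module module]
        bilinear_map_compose[OF bilinear_map_tensor[OF module module] antipode_linear antipode_linear]
        gA gA])
  with antipode_morphism gA show ?thesis
    by (simp add: glike_def coalgebra_endomorphism_def glikeD[OF g] linear_mapD(1)[OF antipode_linear])
qed

text \<open>On \<open>g\<close> the left sides of the antipode axioms have one term each, and the
  right sides become \<open>\<xi>\<close> because \<open>\<epsilon> g\<close> is one.\<close>

lemma glike_antipode_inverse:
  assumes g: "g \<in> glike K A \<Delta> \<epsilon>"
  shows "g \<turnstile> S g = \<xi>" "S g \<stileturn> g = \<xi>"
proof -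
  interpret A: module K A by (rule module)
  note gA = glikeD(1)[OF g]
  have "g \<turnstile> S g = sweedler K A \<Delta> A (\<lambda>a1 a2. a1 \<turnstile> S a2) g"
    by (rule sweedler_glike[OF g module, symmetric])
      (rule bilinear_map_compose[OF lprod_bilinear linear_map_id antipode_linear])
  then show "g \<turnstile> S g = \<xi>"
    using gA by (simp add: antipode_right glikeD(3)[OF g] unit_closed)
  have "S g \<stileturn> g = sweedler K A \<Delta> A (\<lambda>a1 a2. S a1 \<stileturn> a2) g"
    by (rule sweedler_glike[OF g module, symmetric])
      (rule bilinear_map_compose[OF rprod_bilinear antipode_linear linear_map_id])
  then show "S g \<stileturn> g = \<xi>"
    using gA by (simp add: antipode_left glikeD(3)[OF g] unit_closed)
qed

section \<open>Bar-unit, uniqueness of inverses and the digroup structure\<close>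

lemma bar_unit_glike: "bar_unit (glike K A \<Delta> \<epsilon>) (\<turnstile>) (\<stileturn>) \<xi>"
  by (simp add: bar_unit_def glike_def unit_closed unit_comult unit_counit unit_lprod rprod_unit)

lemma glike_inverse_eq:
  assumes g: "g \<in> glike K A \<Delta> \<epsilon>" and y: "y \<in> carrier A" "y \<stileturn> g = \<xi>"
    and z: "z \<in> carrier A" "g \<turnstile> z = \<xi>"
  shows "y = z \<turnstile> \<xi>"
proof -
  note gA = glikeD(1)[OF g]
  have "y = y \<stileturn> (g \<turnstile> z)"
    using y z by (simp add: rprod_unit)
  \<comment> \<open>\<open>right_bar\<close> exchanges the product inside the right argument, after
    which associativity of \<open>\<stileturn>\<close> applies.\<close>
  also have "\<dots> = (y \<stileturn> g) \<stileturn> z"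
    using y(1) z(1) gA by (simp add: rprod_assoc right_bar)
  also have "\<dots> = z \<turnstile> \<xi>"
    using y(2) z(1) by (simp add: unit_balanced)
  finally show ?thesis .
qed

text \<open>As an equivalence this gives both the unique existence required of a digroup and the
  value of the description in \<open>digroup_inverse\<close>.\<close>

lemma digroup_inverse_of_glike_iff:
  assumes g: "g \<in> glike K A \<Delta> \<epsilon>"
  shows "digroup_inverse_of (glike K A \<Delta> \<epsilon>) (\<turnstile>) (\<stileturn>) \<xi> g y \<longleftrightarrow> y = S g"
proof
  assume "digroup_inverse_of (glike K A \<Delta> \<epsilon>) (\<turnstile>) (\<stileturn>) \<xi> g y"
  then have y: "y \<in> carrier A" "y \<stileturn> g = \<xi>"
    by (simp_all add: digroup_inverse_of_def glikeD(1))
  have S: "S g \<in> carrier A" "g \<turnstile> S g = \<xi>" "S g \<stileturn> g = \<xi>"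
    using g glike_antipode glike_antipode_inverse by (auto simp: glikeD(1))
  show "y = S g"
    \<comment> \<open>Both \<open>y\<close> and \<open>S g\<close> are left inverses of
      \<open>g\<close>; compared with the same right inverse \<open>S g\<close>, each equals
      \<open>S g \<turnstile> \<xi>\<close>.\<close>
    using glike_inverse_eq[OF g y S(1,2)] glike_inverse_eq[OF g S(1,3) S(1,2)] by simp
qed (simp add: digroup_inverse_of_def g glike_antipode glike_antipode_inverse)

lemma digroup_glike: "digroup (glike K A \<Delta> \<epsilon>) (\<turnstile>) (\<stileturn>) \<xi>"
proof -
  let ?G = "glike K A \<Delta> \<epsilon>"
  have right_inverse: "\<exists>y\<in>?G. x \<turnstile> y = e" if "bar_unit ?G (\<turnstile>) (\<stileturn>) e" and x: "x \<in> ?G" for e x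
  proof
    have e: "e \<in> ?G"
      using that by (simp add: bar_unit_def)
    \<comment> \<open>Multiplying by \<open>e\<close> on the right moves the value from
      \<open>\<xi>\<close> to \<open>\<xi> \<turnstile> e = e\<close>.\<close>
    show "S x \<turnstile> e \<in> ?G"
      by (intro glike_lprod glike_antipode x e)
    have "x \<turnstile> (S x \<turnstile> e) = (x \<turnstile> S x) \<turnstile> e"
      using x e by (simp add: lprod_assoc glikeD(1) glike_antipode)
    then show "x \<turnstile> (S x \<turnstile> e) = e"
      using x e by (simp add: glike_antipode_inverse unit_lprod glikeD(1))
  qed
  have left_inverse: "\<exists>y\<in>?G. y \<stileturn> x = e" if "bar_unit ?G (\<turnstile>) (\<stileturn>) e" and x: "x \<in> ?G" for e x
  proof
    have e: "e \<in> ?G"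
      using that by (simp add: bar_unit_def)
    \<comment> \<open>The mirror image: reassociation leads to
      \<open>e \<stileturn> \<xi> = e\<close>.\<close>
    show "e \<stileturn> S x \<in> ?G"
      by (intro glike_rprod glike_antipode x e)
    have "(e \<stileturn> S x) \<stileturn> x = e \<stileturn> (S x \<stileturn> x)"
      using x e by (simp add: rprod_assoc glikeD(1) glike_antipode)
    then show "(e \<stileturn> S x) \<stileturn> x = e"
      using x e by (simp add: glike_antipode_inverse rprod_unit glikeD(1))
  qed
  show ?thesis
  proof
    show "?G \<noteq> {}" "\<exists>e. bar_unit ?G (\<turnstile>) (\<stileturn>) e"
      using bar_unit_glike by (auto simp: bar_unit_def)
  next
    fix x y z assume "x \<in> ?G" "y \<in> ?G" "z \<in> ?G"
    then have "x \<in> carrier A" "y \<in> carrier A" "z \<in> carrier A"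
      by (simp_all add: glikeD(1))
    then show "(x \<turnstile> y) \<turnstile> z = x \<turnstile> (y \<turnstile> z)" "(x \<stileturn> y) \<stileturn> z = x \<stileturn> (y \<stileturn> z)"
      "x \<turnstile> (y \<stileturn> z) = (x \<turnstile> y) \<stileturn> z" "x \<stileturn> (y \<stileturn> z) = x \<stileturn> (y \<turnstile> z)"
      "(x \<turnstile> y) \<turnstile> z = (x \<stileturn> y) \<turnstile> z"
      by (fact lprod_assoc rprod_assoc inner_assoc[symmetric] right_bar left_bar)+
  qed (simp_all add: glike_lprod glike_rprod right_inverse left_inverse bar_unit_glike
      digroup_inverse_of_glike_iff)
qed

end

theorem proposition5p2:
  fixes K :: "('k, 'r) ring_scheme"
    and A :: "('k, 'a, 'c) module_scheme"
    and \<Delta> :: "'a \<Rightarrow> ('a \<times> 'a \<Rightarrow> 'k) set"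
    and \<epsilon> :: "'a \<Rightarrow> 'k"
    and \<xi> :: 'a
    and lprod :: "'a \<Rightarrow> 'a \<Rightarrow> 'a"  (infixl \<open>\<turnstile>\<close> 70)
    and rprod :: "'a \<Rightarrow> 'a \<Rightarrow> 'a"  (infixl \<open>\<stileturn>\<close> 70)
    and S :: "'a \<Rightarrow> 'a"
  assumes field: "field K"
    and char_zero: "\<And>n::nat. n \<noteq> 0 \<Longrightarrow> [n] \<cdot>\<^bsub>K\<^esub> \<one>\<^bsub>K\<^esub> \<noteq> \<zero>\<^bsub>K\<^esub>"
    and hopf: "cocommutative_hopf_dialgebra K A \<Delta> \<epsilon> \<xi> (\<turnstile>) (\<stileturn>) S"
  shows "digroup (glike K A \<Delta> \<epsilon>) (\<turnstile>) (\<stileturn>) \<xi> \<and>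
    (\<forall>g\<in>glike K A \<Delta> \<epsilon>. \<forall>h\<in>glike K A \<Delta> \<epsilon>. g \<turnstile> h \<in> glike K A \<Delta> \<epsilon> \<and> g \<stileturn> h \<in> glike K A \<Delta> \<epsilon>) \<and>
    bar_unit (glike K A \<Delta> \<epsilon>) (\<turnstile>) (\<stileturn>) \<xi> \<and>
    (\<forall>g\<in>glike K A \<Delta> \<epsilon>. S g \<in> glike K A \<Delta> \<epsilon> \<and> g \<turnstile> S g = \<xi> \<and> S g \<stileturn> g = \<xi>) \<and>
    (\<forall>g\<in>glike K A \<Delta> \<epsilon>. digroup_inverse (glike K A \<Delta> \<epsilon>) (\<turnstile>) (\<stileturn>) \<xi> g = S g)"
proof -
  interpret cocommutative_hopf_dialgebra K A \<Delta> \<epsilon> \<xi> lprod rprod S by (rule hopf)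
  show ?thesis
    by (simp add: digroup_glike glike_lprod glike_rprod bar_unit_glike glike_antipode
        glike_antipode_inverse digroup_inverse_def digroup_inverse_of_glike_iff)
qed

end
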